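(* Let $V$ be a finite-dimensional irreducible $\mathcal{A}$-module of type $AB(d,n)$. Pick $a,b$ among $x,y,z$ with $a\neq b$, and let $c$ denote the element of $\{x,y,z\}$ other than $a,b$. Let $0\neq v^b\in e_0^bV$ and consider the basis $\{e_{i}^{a}v^{b}\}_{i=0}^{d}$ of $V$. With respect to this basis, the matrices representing $a,b,c$ (rows and columns indexed by $0,\dots,d$) are as follows. The matrix representing $a$ is $\widehat{a}(n)\,\mathrm{diag}((-1)^{d}(2d+1),\ldots,9,-7,5,-3,1)$, i.e. diagonal with $(i,i)$-entry $\widehat a(n)(-1)^{d+i}(2d-2i+1)$ for $0\le i\le d$. The matrix representing $b$ is $\widehat b(n)(-1)^d$ times the tridiagonal matrix with $(i-1,i)$-entry $2d-i+2$ and $(i,i-1)$-entry $i$ for $1\le i\le d$, $(d,d)$-entry $d+1$, and all other diagonal entries zero. The matrix representing $c$ is $\widehat c(n)$ times the tridiagonal matrix with $(i-1,i)$-entry $(-1)^{i-1}(2d-i+2)$ and $(i,i-1)$-entry $(-1)^{i-1}i$ for $1\le i\le d$, $(d,d)$-entry $(-1)^d(d+1)$, and all other diagonal entries zero.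
   Context: $\mathbb{K}$ is an algebraically closed field of characteristic zero. $\mathcal{A}$ is the unital associative $\mathbb{K}$-algebra with generators $x,y,z$ and relations $xy+yx=2z$, $yz+zy=2x$, $zx+xz=2y$. For $a\in\{x,y,z\}$ and $n\in\{0,x,y,z\}$ (a set of four symbols) put $\widehat a(n)=1$ if $n\in\{0,a\}$ and $\widehat a(n)=-1$ otherwise. Type $AB(d,n)$ ($d\ge 0$ an integer, $n\in\{0,x,y,z\}$): an $\mathcal{A}$-module is of type $AB(d,n)$ if it is isomorphic to the irreducible module with basis $\{v_i\}_{i=0}^d$ and, for $0\le i\le d$: $x.v_i=\widehat x(n)(-1)^{d+i}(2d-2i+1)v_i$, $y.v_i=\widehat y(n)(-1)^d\big((2d-i+2)v_{i-1}+(i+1)v_{i+1}\big)$, $z.v_i=\widehat z(n)\big((-1)^{i-1}(2d-i+2)v_{i-1}+(-1)^i(i+1)v_{i+1}\big)$, with $v_{-1}=0$, $v_{d+1}=v_d$. On a module $V$ of type $AB(d,n)$ each $a\in\{x,y,z\}$ acts diagonalizably with the $d+1$ mutually distinct eigenvalues $\theta_i^a=\widehat a(n)(-1)^{d+i}(2d-2i+1)$, $0\le i\le d$. The primitive idempotent $e_i^a\in\mathrm{End}(V)$ is the projection onto the $\theta_i^a$-eigenspace of $a$ that vanishes on the other eigenspaces of $a$. For $a\ne b$ and $0\ne v^b\in e_0^bV$, the vectors $\{e_i^av^b\}_{i=0}^d$ form a basis of $V$. Convention: the matrix $B$ represents a linear map $T$ with respect to a basis $\{u_i\}_{i=0}^d$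 if $Tu_j=\sum_{i=0}^dB_{ij}u_i$ for all $j$. *)

theory Defs
  imports
    Complex_Main
    "HOL-Library.Poly_Mapping"
    "HOL-Computational_Algebra.Polynomial"
begin

section \<open>The algebra\<close>

datatype gen = gx | gy | gz

text \<open>
  Words in the generators form the free monoid, written additively because
  \<open>poly_mapping\<close> builds monoid algebras over an additive index monoid.  So
  \<open>gword \<Rightarrow>\<^sub>0 'k\<close> is the free unital associative algebra on \<open>gx\<close>, \<open>gy\<close>, \<open>gz\<close>.
\<close>

datatype gword = Word (letters: "gen list")

instantiation gword :: monoid_add
begin
definition zero_gword :: gword where "0 = Word []"
definition plus_gword :: "gword \<Rightarrow> gword \<Rightarrow> gword" where
  "u + v = Word (letters u @ letters v)"
instance by standard (simp_all add: zero_gword_def plus_gword_def)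
end

definition free_gen :: "gen \<Rightarrow> (gword \<Rightarrow>\<^sub>0 'k::field)" where
  "free_gen g = Poly_Mapping.single (Word [g]) 1"

definition free_const :: "'k::field \<Rightarrow> (gword \<Rightarrow>\<^sub>0 'k)" where
  "free_const c = Poly_Mapping.single 0 c"

definition relators :: "(gword \<Rightarrow>\<^sub>0 'k::field) set" where
  "relators =
    {free_gen gx * free_gen gy + free_gen gy * free_gen gx - 2 * free_gen gz,
     free_gen gy * free_gen gz + free_gen gz * free_gen gy - 2 * free_gen gx,
     free_gen gz * free_gen gx + free_gen gx * free_gen gz - 2 * free_gen gy}"

text \<open>The two-sided ideal generated by the relators.\<close>

inductive_set rel_ideal :: "(gword \<Rightarrow>\<^sub>0 'k::field) set" where
  zero: "0 \<in> rel_ideal"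
| add: "p \<in> rel_ideal \<Longrightarrow> q \<in> rel_ideal \<Longrightarrow> p + q \<in> rel_ideal"
| gen: "r \<in> relators \<Longrightarrow> p * r * q \<in> rel_ideal"

lemma rel_ideal_mult_left: "p \<in> rel_ideal \<Longrightarrow> s * p \<in> rel_ideal"
proof (induction rule: rel_ideal.induct)
  case (gen r p q)
  then show ?case using rel_ideal.gen[of r "s * p" q] by (simp add: mult.assoc)
qed (auto simp: distrib_left intro: rel_ideal.intros)

lemma rel_ideal_mult_right: "p \<in> rel_ideal \<Longrightarrow> p * s \<in> rel_ideal"
proof (induction rule: rel_ideal.induct)
  case (gen r p q)
  then show ?case using rel_ideal.gen[of r p "q * s"] by (simp add: mult.assoc)
qed (auto simp: distrib_right intro: rel_ideal.intros)

lemma rel_ideal_uminus: "p \<in> rel_ideal \<Longrightarrow> - p \<in> rel_ideal"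
  using rel_ideal_mult_left[of p "- 1"] by simp

lemma rel_ideal_diff: "p \<in> rel_ideal \<Longrightarrow> q \<in> rel_ideal \<Longrightarrow> p - q \<in> rel_ideal"
  using rel_ideal.add[of p "- q"] rel_ideal_uminus[of q] by simp

definition rel_cong :: "(gword \<Rightarrow>\<^sub>0 'k::field) \<Rightarrow> (gword \<Rightarrow>\<^sub>0 'k) \<Rightarrow> bool" where
  "rel_cong p q \<longleftrightarrow> p - q \<in> rel_ideal"

lemma equivp_rel_cong: "equivp (rel_cong :: (gword \<Rightarrow>\<^sub>0 'k::field) \<Rightarrow> _)"
proof (rule equivpI)
  show "reflp (rel_cong :: (gword \<Rightarrow>\<^sub>0 'k) \<Rightarrow> _)"
    by (auto intro!: reflpI simp: rel_cong_def rel_ideal.zero)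
  show "symp (rel_cong :: (gword \<Rightarrow>\<^sub>0 'k) \<Rightarrow> _)"
  proof (rule sympI)
    fix p q :: "gword \<Rightarrow>\<^sub>0 'k"
    assume "rel_cong p q"
    then show "rel_cong q p"
      using rel_ideal_uminus[of "p - q"] by (simp add: rel_cong_def)
  qed
  show "transp (rel_cong :: (gword \<Rightarrow>\<^sub>0 'k) \<Rightarrow> _)"
  proof (rule transpI)
    fix p q r :: "gword \<Rightarrow>\<^sub>0 'k"
    assume "rel_cong p q" "rel_cong q r"
    then show "rel_cong p r"
      using rel_ideal.add[of "p - q" "q - r"] by (simp add: rel_cong_def)
  qed
qed

quotient_type (overloaded) 'k spin_alg = "gword \<Rightarrow>\<^sub>0 ('k::field)" / rel_cong
  by (rule equivp_rel_cong)

text \<open>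
  Class \<open>ring_1\<close> would demand \<open>0 \<noteq> 1\<close>; unital rings are covered by
  \<open>ring\<close> together with \<open>monoid_mult\<close>.
\<close>

instantiation spin_alg :: (field) "{ring, monoid_mult}"
begin

lift_definition zero_spin_alg :: "'a spin_alg" is 0 .

lift_definition one_spin_alg :: "'a spin_alg" is 1 .

lift_definition plus_spin_alg :: "'a spin_alg \<Rightarrow> 'a spin_alg \<Rightarrow> 'a spin_alg" is "(+)"
proof -
  fix p p' q q' :: "gword \<Rightarrow>\<^sub>0 'a"
  assume "rel_cong p p'" "rel_cong q q'"
  then show "rel_cong (p + q) (p' + q')"
    using rel_ideal.add[of "p - p'" "q - q'"] by (simp add: rel_cong_def algebra_simps)
qed

lift_definition uminus_spin_alg :: "'a spin_alg \<Rightarrow> 'a spin_alg" is uminus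
proof -
  fix p p' :: "gword \<Rightarrow>\<^sub>0 'a"
  assume "rel_cong p p'"
  then show "rel_cong (- p) (- p')"
    using rel_ideal_uminus[of "p - p'"] by (simp add: rel_cong_def algebra_simps)
qed

lift_definition minus_spin_alg :: "'a spin_alg \<Rightarrow> 'a spin_alg \<Rightarrow> 'a spin_alg" is "(-)"
proof -
  fix p p' q q' :: "gword \<Rightarrow>\<^sub>0 'a"
  assume "rel_cong p p'" "rel_cong q q'"
  then show "rel_cong (p - q) (p' - q')"
    using rel_ideal_diff[of "p - p'" "q - q'"] by (simp add: rel_cong_def algebra_simps)
qed

lift_definition times_spin_alg :: "'a spin_alg \<Rightarrow> 'a spin_alg \<Rightarrow> 'a spin_alg" is "(*)"
proof -
  fix p p' q q' :: "gword \<Rightarrow>\<^sub>0 'a"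
  assume "rel_cong p p'" "rel_cong q q'"
  then have "(p - p') * q + p' * (q - q') \<in> rel_ideal"
    unfolding rel_cong_def
    by (intro rel_ideal.add rel_ideal_mult_left rel_ideal_mult_right)
  then show "rel_cong (p * q) (p' * q')"
    by (simp add: rel_cong_def algebra_simps)
qed

instance
  by standard (transfer; simp add: rel_cong_def algebra_simps rel_ideal.zero)+

end

lift_definition alg_gen :: "gen \<Rightarrow> 'k::field spin_alg" is free_gen .

text \<open>The structure map of the \<open>'k\<close>-algebra; scalar multiplication is \<open>alg_const c * p\<close>.\<close>

lift_definition alg_const :: "'k::field \<Rightarrow> 'k spin_alg" is free_const .


section \<open>Modules\<close>

locale A_module = vector_space scale
  for scale :: "'k::field \<Rightarrow> 'v::ab_group_add \<Rightarrow> 'v" +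
  fixes act :: "'k spin_alg \<Rightarrow> 'v \<Rightarrow> 'v"
  assumes act_add_right: "act p (v + w) = act p v + act p w"
    and act_add_left: "act (p + q) v = act p v + act q v"
    and act_mult: "act (p * q) v = act p (act q v)"
    and act_one: "act 1 v = v"
    and act_const: "act (alg_const c) v = scale c v"

definition submodule ::
  "('k::field \<Rightarrow> 'v::ab_group_add \<Rightarrow> 'v) \<Rightarrow> ('k spin_alg \<Rightarrow> 'v \<Rightarrow> 'v) \<Rightarrow> 'v set \<Rightarrow> bool" where
  "submodule scale act W \<longleftrightarrow> module.subspace scale W \<and> (\<forall>p. \<forall>w\<in>W. act p w \<in> W)"

definition irreducible_module ::
  "('k::field \<Rightarrow> 'v::ab_group_add \<Rightarrow> 'v) \<Rightarrow> ('k spin_alg \<Rightarrow> 'v \<Rightarrow> 'v) \<Rightarrow> bool" where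
  "irreducible_module scale act \<longleftrightarrow>
     A_module scale act \<and> (UNIV :: 'v set) \<noteq> {0} \<and>
     (\<forall>W. submodule scale act W \<longrightarrow> W = {0} \<or> W = UNIV)"

definition finite_dim :: "('k::field \<Rightarrow> 'v::ab_group_add \<Rightarrow> 'v) \<Rightarrow> bool" where
  "finite_dim scale \<longleftrightarrow> (\<exists>B. finite B \<and> module.span scale B = UNIV)"

definition indexed_basis ::
  "('k::field \<Rightarrow> 'v::ab_group_add \<Rightarrow> 'v) \<Rightarrow> nat \<Rightarrow> (nat \<Rightarrow> 'v) \<Rightarrow> bool" where
  "indexed_basis scale d u \<longleftrightarrow>
     inj_on u {..d} \<and> \<not> module.dependent scale (u ` {..d}) \<and>
     module.span scale (u ` {..d}) = UNIV"

definition represents ::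
  "('k::field \<Rightarrow> 'v::ab_group_add \<Rightarrow> 'v) \<Rightarrow> nat \<Rightarrow> (nat \<Rightarrow> 'v) \<Rightarrow>
   ('v \<Rightarrow> 'v) \<Rightarrow> (nat \<Rightarrow> nat \<Rightarrow> 'k) \<Rightarrow> bool" where
  "represents scale d u T B \<longleftrightarrow>
     (\<forall>j\<le>d. T (u j) = (\<Sum>i\<le>d. scale (B i j) (u i)))"


section \<open>Type AB\<close>

text \<open>The index set \<open>{0, x, y, z}\<close> is \<open>gen option\<close>, with \<open>None\<close> for the symbol \<open>0\<close>.\<close>

definition hat :: "gen \<Rightarrow> gen option \<Rightarrow> 'k::field" where
  "hat a n = (if n = None \<or> n = Some a then 1 else - 1)"

text \<open>The boundary conventions \<open>v\<^bsub>-1\<^esub> = 0\<close> and \<open>v\<^bsub>d+1\<^esub> = v\<^bsub>d\<^esub>\<close>.\<close>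

definition extend :: "nat \<Rightarrow> (nat \<Rightarrow> 'v::zero) \<Rightarrow> int \<Rightarrow> 'v" where
  "extend d v i = (if i < 0 then 0 else if i = int d + 1 then v d else v (nat i))"

definition AB_basis ::
  "nat \<Rightarrow> gen option \<Rightarrow> ('k::field \<Rightarrow> 'v::ab_group_add \<Rightarrow> 'v) \<Rightarrow>
   ('k spin_alg \<Rightarrow> 'v \<Rightarrow> 'v) \<Rightarrow> (nat \<Rightarrow> 'v) \<Rightarrow> bool" where
  "AB_basis d n scale act v \<longleftrightarrow> indexed_basis scale d v \<and>
     (\<forall>i\<le>d.
        act (alg_gen gx) (v i) =
          scale (hat gx n * (- 1) ^ (d + i) * (2 * of_nat d - 2 * of_nat i + 1)) (v i) \<and>
        act (alg_gen gy) (v i) =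
          scale (hat gy n * (- 1) ^ d)
            (scale (2 * of_nat d - of_nat i + 2) (extend d v (int i - 1)) +
             scale (of_nat i + 1) (extend d v (int i + 1))) \<and>
        act (alg_gen gz) (v i) =
          scale (hat gz n)
            (scale ((- 1) powi (int i - 1) * (2 * of_nat d - of_nat i + 2))
               (extend d v (int i - 1)) +
             scale ((- 1) ^ i * (of_nat i + 1)) (extend d v (int i + 1))))"

text \<open>
  A module is isomorphic to the module with basis \<open>v\<^sub>0, \<dots>, v\<^sub>d\<close> and the prescribed action
  iff it has itself a basis on which the generators act in the prescribed way.
\<close>

definition type_AB ::
  "nat \<Rightarrow> gen option \<Rightarrow> ('k::field \<Rightarrow> 'v::ab_group_add \<Rightarrow> 'v) \<Rightarrow>
   ('k spin_alg \<Rightarrow> 'v \<Rightarrow> 'v) \<Rightarrow> bool" where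
  "type_AB d n scale act \<longleftrightarrow>
     irreducible_module scale act \<and> (\<exists>v. AB_basis d n scale act v)"

definition eigval :: "nat \<Rightarrow> gen option \<Rightarrow> gen \<Rightarrow> nat \<Rightarrow> 'k::field" where
  "eigval d n a i = hat a n * (- 1) ^ (d + i) * (2 * of_nat d - 2 * of_nat i + 1)"

definition eigenspace ::
  "('k::field \<Rightarrow> 'v::ab_group_add \<Rightarrow> 'v) \<Rightarrow> ('v \<Rightarrow> 'v) \<Rightarrow> 'k \<Rightarrow> 'v set" where
  "eigenspace scale T \<theta> = {v. T v = scale \<theta> v}"

text \<open>
  The description is proper if \<open>T\<close> is diagonalizable: then the eigenspaces span the space
  and the conditions determine \<open>E\<close>.
\<close>

definition prim_idem ::
  "('k::field \<Rightarrow> 'v::ab_group_add \<Rightarrow> 'v) \<Rightarrow> ('v \<Rightarrow> 'v) \<Rightarrow> 'k \<Rightarrow> 'v \<Rightarrow> 'v" where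
  "prim_idem scale T \<theta> =
     (THE E. Vector_Spaces.linear scale scale E \<and>
             (\<forall>v. E (E v) = E v) \<and> range E = eigenspace scale T \<theta> \<and>
             (\<forall>\<mu>. \<mu> \<noteq> \<theta> \<longrightarrow> (\<forall>v\<in>eigenspace scale T \<mu>. E v = 0)))"

definition idem ::
  "nat \<Rightarrow> gen option \<Rightarrow> ('k::field \<Rightarrow> 'v::ab_group_add \<Rightarrow> 'v) \<Rightarrow>
   ('k spin_alg \<Rightarrow> 'v \<Rightarrow> 'v) \<Rightarrow> gen \<Rightarrow> nat \<Rightarrow> 'v \<Rightarrow> 'v" where
  "idem d n scale act a i = prim_idem scale (act (alg_gen a)) (eigval d n a i)"


section \<open>The three matrices\<close>

definition mat_diag :: "nat \<Rightarrow> gen option \<Rightarrow> gen \<Rightarrow> nat \<Rightarrow> nat \<Rightarrow> 'k::field" where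
  "mat_diag d n a i j =
     (if i = j then hat a n * (- 1) ^ (d + i) * (2 * of_nat d - 2 * of_nat i + 1) else 0)"

definition mat_tri :: "nat \<Rightarrow> gen option \<Rightarrow> gen \<Rightarrow> nat \<Rightarrow> nat \<Rightarrow> 'k::field" where
  "mat_tri d n b i j = hat b n * (- 1) ^ d *
     (if j = i + 1 then 2 * of_nat d - of_nat j + 2
      else if i = j + 1 then of_nat i
      else if i = d \<and> j = d then of_nat d + 1
      else 0)"

definition mat_alt_tri :: "nat \<Rightarrow> gen option \<Rightarrow> gen \<Rightarrow> nat \<Rightarrow> nat \<Rightarrow> 'k::field" where
  "mat_alt_tri d n c i j = hat c n *
     (if j = i + 1 then (- 1) ^ (j - 1) * (2 * of_nat d - of_nat j + 2)
      else if i = j + 1 then (- 1) ^ (i - 1) * of_nat i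
      else if i = d \<and> j = d then (- 1) ^ d * (of_nat d + 1)
      else 0)"

end

theory Submission
  imports Defs
begin

text \<open>
  Rescaling each generator by its sign \<open>hat\<close> gives operators \<open>A, B, C\<close> with
  \<open>A B + B A = 2 C\<close> and its permutations, so the claim is symmetric in the generators once a
  type AB basis exists for every ordering.  Exchanging \<open>B\<close> and \<open>C\<close> only needs signs on the
  basis vectors.  To exchange \<open>A\<close> and \<open>B\<close>, note that \<open>\<Sum>i\<le>d. v i\<close> is a \<open>B\<close>-eigenvector and that on
  \<open>B\<close>-eigenvectors \<open>A \<plusminus> C\<close> shift the eigenvalue; iterating gives the new basis \<open>w\<close>, and the central
  element \<open>A\<^sup>2 + B\<^sup>2 + C\<^sup>2\<close> determines the lowering coefficients.  The boundary gives \<open>w (d + 1) = \<kappa> w d\<close> with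
  \<open>\<kappa>\<^sup>2 = 1\<close>, and \<open>\<kappa> = -1\<close> would make \<open>\<Sum>i\<le>d. (- 1)\<^sup>i w i\<close> an \<open>A\<close>-eigenvector for a non-eigenvalue.
  Finally \<open>v\<^sup>b\<close> and \<open>\<Sum>i\<le>d. v i\<close> lie in the same one-dimensional \<open>b\<close>-eigenspace, so the vectors
  \<open>e\<^sub>i\<^sup>a v\<^sup>b\<close> form a multiple of the type AB basis for the ordering \<open>a, b, c\<close>.
\<close>

section \<open>Linear algebra of operators with distinct eigenvalues\<close>

definition eigenbasis ::
  "('k::field \<Rightarrow> 'v::ab_group_add \<Rightarrow> 'v) \<Rightarrow> ('v \<Rightarrow> 'v) \<Rightarrow> (nat \<Rightarrow> 'k) \<Rightarrow> nat \<Rightarrow> (nat \<Rightarrow> 'v) \<Rightarrow> bool"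
where
  "eigenbasis scale T l d u \<longleftrightarrow> Vector_Spaces.linear scale scale T \<and> indexed_basis scale d u \<and>
     inj_on l {..d} \<and> (\<forall>i\<le>d. T (u i) = scale (l i) (u i))"

context vector_space
begin

text \<open>Applying \<open>T\<close> to a relation and subtracting \<open>l m\<close> times the
  relation removes the term of the new index \<open>m\<close> and multiplies every other coefficient
  by a nonzero \<open>l i - l m\<close>, so induction on \<open>S\<close> applies.\<close>

lemma eigenvectors_coeffs_zero:
  assumes T: "Vector_Spaces.linear scale scale T" and "finite S" and "inj_on l S"
    and "\<And>i. i \<in> S \<Longrightarrow> T (u i) = scale (l i) (u i)" and "\<And>i. i \<in> S \<Longrightarrow> u i \<noteq> 0"
    and "(\<Sum>i\<in>S. scale (g i) (u i)) = 0" and "k \<in> S"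
  shows "g k = 0"
  using assms(2-)
proof (induction S arbitrary: g k rule: finite_induct)
  case (insert m S)
  interpret T: Vector_Spaces.linear scale scale T by fact
  have sum0: "scale (g m) (u m) + (\<Sum>i\<in>S. scale (g i) (u i)) = 0"
    using insert.prems insert.hyps by simp
  have "T (scale (g m) (u m) + (\<Sum>i\<in>S. scale (g i) (u i))) = 0"
    by (simp add: sum0 T.zero)
  then have "scale (g m * l m) (u m) + (\<Sum>i\<in>S. scale (g i * l i) (u i)) = 0"
    using insert.prems by (simp add: T.add T.sum T.scale)
  moreover have "scale (g m * l m) (u m) + (\<Sum>i\<in>S. scale (g i * l m) (u i)) = 0"
    using arg_cong[OF sum0, of "scale (l m)"]
    by (simp add: scale_right_distrib scale_sum_right mult.commute)
  ultimately have "(\<Sum>i\<in>S. scale (g i * l i) (u i)) - (\<Sum>i\<in>S. scale (g i * l m) (u i)) = 0"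
    by (metis add_left_imp_eq eq_iff_diff_eq_0)
  then have "(\<Sum>i\<in>S. scale (g i * (l i - l m)) (u i)) = 0"
    by (simp add: sum_subtractf[symmetric] scale_left_diff_distrib right_diff_distrib)
  then have "g i * (l i - l m) = 0" if "i \<in> S" for i
    using insert.IH[of "\<lambda>i. g i * (l i - l m)"] insert.prems that by auto
  moreover have "l i \<noteq> l m" if "i \<in> S" for i
    using that insert.prems(1) insert.hyps(2) by (auto simp: inj_on_def)
  ultimately have z: "g i = 0" if "i \<in> S" for i
    using that by fastforce
  then have "scale (g m) (u m) = 0"
    using sum0 by simp
  then have "g m = 0"
    using insert.prems(3)[of m] by simp
  then show ?case
    using z insert.prems(5) by auto
qed simp

lemma eigenvectors_indexed_independent:
  assumes T: "Vector_Spaces.linear scale scale T" and "inj_on l {..d::nat}"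
    and eig: "\<And>i. i \<le> d \<Longrightarrow> T (u i) = scale (l i) (u i)" and nz: "\<And>i. i \<le> d \<Longrightarrow> u i \<noteq> 0"
  shows "inj_on u {..d}" and "independent (u ` {..d})"
proof -
  show inj: "inj_on u {..d}"
  proof (rule inj_onI)
    fix i j assume ij: "i \<in> {..d}" "j \<in> {..d}" "u i = u j"
    then have "scale (l i) (u i) = scale (l j) (u i)"
      using eig by (metis atMost_iff)
    then show "i = j"
      using ij nz \<open>inj_on l {..d}\<close> by (auto simp: inj_on_def)
  qed
  show "independent (u ` {..d})"
  proof
    assume "dependent (u ` {..d})"
    then obtain g where g: "\<exists>v\<in>u ` {..d}. g v \<noteq> 0" "(\<Sum>v\<in>u ` {..d}. scale (g v) v) = 0"
      by (auto simp: dependent_finite)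
    then have "(\<Sum>i\<le>d. scale (g (u i)) (u i)) = 0"
      by (simp add: sum.reindex[OF inj])
    then have "g (u i) = 0" if "i \<le> d" for i
      using eigenvectors_coeffs_zero[OF T, of "{..d}" l u "\<lambda>i. g (u i)" i] assms that by auto
    then show False
      using g by auto
  qed
qed

lemma indexed_basis_coords:
  assumes "indexed_basis scale d u"
  obtains g where "v = (\<Sum>i\<le>d. scale (g i) (u i))"
proof -
  have inj: "inj_on u {..d}" and "v \<in> span (u ` {..d})"
    using assms by (auto simp: indexed_basis_def)
  then obtain g where "v = (\<Sum>w\<in>u ` {..d}. scale (g w) w)"
    by (auto simp: span_finite)
  then show thesis
    using that[of "\<lambda>i. g (u i)"] by (simp add: sum.reindex[OF inj])
qed

lemma indexed_basis_coeffs_zero: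
  assumes "indexed_basis scale d u" and "(\<Sum>i\<le>d. scale (g i) (u i)) = 0" and "k \<le> d"
  shows "g k = 0"
proof -
  have inj: "inj_on u {..d}" and ind: "independent (u ` {..d})"
    using assms by (auto simp: indexed_basis_def)
  define h where "h w = g (the_inv_into {..d} u w)" for w
  have h: "h (u i) = g i" if "i \<le> d" for i
    using that by (simp add: h_def the_inv_into_f_f[OF inj])
  have "(\<Sum>w\<in>u ` {..d}. scale (h w) w) = 0"
    using assms(2) by (simp add: sum.reindex[OF inj] h)
  then have "h (u k) = 0"
    using ind \<open>k \<le> d\<close> dependent_finite[of "u ` {..d}"] by blast
  then show ?thesis
    using h \<open>k \<le> d\<close> by simp
qed

lemma indexed_basis_sum_nonzero:
  assumes "indexed_basis scale d u"
  shows "(\<Sum>i\<le>d. u i) \<noteq> 0"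
  using indexed_basis_coeffs_zero[OF assms, of "\<lambda>_. 1" 0] by auto

text \<open>A dimension count: a vector outside the span would extend \<open>w\<close> to
  \<open>d + 2\<close> independent vectors in a space spanned by \<open>d + 1\<close>.\<close>

lemma indexed_basis_if_independent:
  assumes "indexed_basis scale d u" and w: "inj_on w {..d}" "independent (w ` {..d})"
  shows "indexed_basis scale d w"
proof -
  have card: "card (w ` {..d}) = Suc d" "card (u ` {..d}) = Suc d"
    using assms by (auto simp: card_image indexed_basis_def)
  have "x \<in> span (w ` {..d})" for x
  proof (rule ccontr)
    assume x: "x \<notin> span (w ` {..d})"
    then have "independent (insert x (w ` {..d}))" "x \<notin> w ` {..d}"
      using w span_base by (auto simp: independent_insert)
    moreover have "insert x (w ` {..d}) \<subseteq> span (u ` {..d})"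
      using assms by (auto simp: indexed_basis_def)
    ultimately have "card (insert x (w ` {..d})) \<le> card (u ` {..d})"
      using independent_span_bound[of "u ` {..d}"] by blast
    then show False
      using card \<open>x \<notin> w ` {..d}\<close> by simp
  qed
  then show ?thesis
    using w by (auto simp: indexed_basis_def)
qed

text \<open>Besides genuine rescaling, the constant factor \<open>1\<close> transfers the basis
  property between sequences that agree only up to \<open>d\<close>.\<close>

lemma indexed_basis_rescale:
  assumes u: "indexed_basis scale d u" and nz: "\<And>i. i \<le> d \<Longrightarrow> s i \<noteq> 0"
    and w: "\<And>i. i \<le> d \<Longrightarrow> w i = scale (s i) (u i)"
  shows "indexed_basis scale d w"
proof (rule indexed_basis_if_independent[OF u])
  have coeffs: "h i = 0" if "(\<Sum>i\<le>d. scale (h i) (w i)) = 0" "i \<le> d" for h i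
    using indexed_basis_coeffs_zero[OF u, of "\<lambda>i. h i * s i" i] that nz[of i] w by simp
  show inj: "inj_on w {..d}"
  proof (rule inj_onI, rule ccontr)
    fix i j assume ij: "i \<in> {..d}" "j \<in> {..d}" "w i = w j" "i \<noteq> j"
    \<comment> \<open>A repeated vector yields a nontrivial relation: coefficient \<open>1\<close>
      at \<open>i\<close> and \<open>- 1\<close> at \<open>j\<close>.\<close>
    define h :: "nat \<Rightarrow> 'a" where "h m = of_bool (m = i) - of_bool (m = j)" for m
    have "(\<Sum>m\<le>d. scale (h m) (w m)) = (\<Sum>m\<le>d. (if m = i then w i else 0) - (if m = j then w j else 0))"
      by (rule sum.cong) (auto simp: h_def)
    also have "\<dots> = 0"
      using ij by (simp add: sum_subtractf)
    finally have "h i = 0"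
      using coeffs ij by auto
    then show False
      using ij by (simp add: h_def)
  qed
  show "independent (w ` {..d})"
  proof
    assume "dependent (w ` {..d})"
    then obtain g where g: "\<exists>v\<in>w ` {..d}. g v \<noteq> 0" "(\<Sum>v\<in>w ` {..d}. scale (g v) v) = 0"
      by (auto simp: dependent_finite)
    then have "(\<Sum>i\<le>d. scale (g (w i)) (w i)) = 0"
      by (simp add: sum.reindex[OF inj])
    then show False
      using coeffs[of "\<lambda>i. g (w i)"] g by auto
  qed
qed

lemma eigenbasis_eigenvector_coeff:
  assumes "eigenbasis scale T l d u" and "T v = scale m v" and v: "v = (\<Sum>i\<le>d. scale (g i) (u i))"
    and "i \<le> d" and "l i \<noteq> m"
  shows "g i = 0"
proof -
  interpret T: Vector_Spaces.linear scale scale T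
    using assms by (simp add: eigenbasis_def)
  have "(\<Sum>i\<le>d. scale (g i * l i) (u i)) = T v"
    using assms(1) by (simp add: v T.sum T.scale eigenbasis_def)
  also have "\<dots> = (\<Sum>i\<le>d. scale (g i * m) (u i))"
    unfolding assms(2) by (simp add: v scale_sum_right mult.commute)
  finally have "(\<Sum>i\<le>d. scale (g i * (l i - m)) (u i)) = 0"
    by (simp add: scale_left_diff_distrib right_diff_distrib sum_subtractf)
  then have "g i * (l i - m) = 0"
    using indexed_basis_coeffs_zero[of d u "\<lambda>i. g i * (l i - m)" i] assms by (auto simp: eigenbasis_def)
  then show ?thesis
    using assms by simp
qed

lemma eigenbasis_eigenvalue:
  assumes "eigenbasis scale T l d u" and "T v = scale m v" and "v \<noteq> 0"
  obtains i where "i \<le> d" and "m = l i"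
proof -
  obtain g where g: "v = (\<Sum>i\<le>d. scale (g i) (u i))"
    using indexed_basis_coords assms unfolding eigenbasis_def by blast
  have "\<exists>i\<le>d. g i \<noteq> 0"
  proof (rule ccontr)
    assume "\<not> ?thesis"
    then have "v = 0"
      unfolding g by (intro sum.neutral) auto
    then show False
      using \<open>v \<noteq> 0\<close> by simp
  qed
  then obtain i where i: "i \<le> d" "g i \<noteq> 0"
    by blast
  then have "l i = m"
    using eigenbasis_eigenvector_coeff[OF assms(1,2) g] by blast
  then show thesis
    using that i by blast
qed

text \<open>Distinct eigenvalues leave an eigenvector at most one nonzero coordinate. This
  one-dimensionality later forces vectors to be proportional.\<close>

lemma eigenspace_eigenbasis:
  assumes "eigenbasis scale T l d u" and "k \<le> d"
  shows "eigenspace scale T (l k) = range (\<lambda>c. scale c (u k))"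
proof -
  interpret T: Vector_Spaces.linear scale scale T
    using assms by (simp add: eigenbasis_def)
  have "v \<in> range (\<lambda>c. scale c (u k))" if v: "T v = scale (l k) v" for v
  proof -
    obtain g where g: "v = (\<Sum>i\<le>d. scale (g i) (u i))"
      using indexed_basis_coords assms unfolding eigenbasis_def by blast
    have "g i = 0" if "i \<le> d" "i \<noteq> k" for i
      using eigenbasis_eigenvector_coeff[OF assms(1) v g] that assms
      by (auto simp: eigenbasis_def inj_on_def)
    then have "v = (\<Sum>i\<le>d. if i = k then scale (g k) (u k) else 0)"
      unfolding g by (intro sum.cong) auto
    then have "v = scale (g k) (u k)"
      using assms(2) by simp
    then show ?thesis
      by (rule range_eqI)
  qed
  moreover have "T (scale c (u k)) = scale (l k) (scale c (u k))" for c
    using assms by (simp add: T.scale eigenbasis_def mult.commute)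
  ultimately show ?thesis
    by (auto simp: eigenspace_def)
qed

text \<open>Discharges the definite description in \<open>prim_idem\<close>: the projection onto
  coordinate \<open>k\<close> has the defining properties, and these properties fix the value at
  every \<open>u j\<close>, so no other map has them.\<close>

lemma prim_idem_eigenbasis:
  assumes eb: "eigenbasis scale T l d u" and k: "k \<le> d"
  shows "Vector_Spaces.linear scale scale (prim_idem scale T (l k))" (is ?lin)
    and "range (prim_idem scale T (l k)) = eigenspace scale T (l k)" (is ?ran)
    and "j \<le> d \<Longrightarrow> prim_idem scale T (l k) (u j) = (if j = k then u k else 0)" (is "_ \<Longrightarrow> ?val")
proof -
  have ib: "indexed_basis scale d u" and inj: "inj_on u {..d}" and linj: "inj_on l {..d}"
    and ind: "independent (u ` {..d})" and span: "span (u ` {..d}) = UNIV"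
    using eb by (auto simp: eigenbasis_def indexed_basis_def)
  define P where "P E \<longleftrightarrow> Vector_Spaces.linear scale scale E \<and>
             (\<forall>v. E (E v) = E v) \<and> range E = eigenspace scale T (l k) \<and>
             (\<forall>\<mu>. \<mu> \<noteq> l k \<longrightarrow> (\<forall>v\<in>eigenspace scale T \<mu>. E v = 0))" for E
  have P_val: "E (u j) = (if j = k then u k else 0)" if "P E" "j \<le> d" for E j
  proof (cases "j = k")
    case True
    have "u k \<in> range E"
      using that k eb by (auto simp: P_def eigenspace_def eigenbasis_def)
    then obtain y where y: "u k = E y" ..
    have "E (E y) = E y"
      using that unfolding P_def by blast
    then show ?thesis
      using True y by simp
  next
    case False
    then have "l j \<noteq> l k" "u j \<in> eigenspace scale T (l j)"
      using linj that k eb by (auto simp: inj_on_def eigenspace_def eigenbasis_def)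
    then show ?thesis
      using False that by (auto simp: P_def)
  qed
  interpret vector_space_pair scale scale ..
  obtain E where E: "Vector_Spaces.linear scale scale E"
    and E_val: "\<And>x. x \<in> u ` {..d} \<Longrightarrow> E x = (if x = u k then u k else 0)"
    using linear_independent_extend[OF ind, of "\<lambda>x. if x = u k then u k else 0"] by blast
  interpret E: Vector_Spaces.linear scale scale E by fact
  have E_u: "E (u j) = (if j = k then u k else 0)" if "j \<le> d" for j
    using E_val[of "u j"] that k inj by (auto simp: inj_on_def)
  have E_sum: "E (\<Sum>i\<le>d. scale (g i) (u i)) = scale (g k) (u k)" for g
  proof -
    have "E (\<Sum>i\<le>d. scale (g i) (u i)) = (\<Sum>i\<le>d. scale (g i) (E (u i)))"
      by (simp add: E.sum E.scale)
    also have "\<dots> = (\<Sum>i\<le>d. if i = k then scale (g k) (u k) else 0)"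
      by (rule sum.cong) (auto simp: E_u)
    finally have "E (\<Sum>i\<le>d. scale (g i) (u i)) = (\<Sum>i\<le>d. if i = k then scale (g k) (u k) else 0)" .
    then show ?thesis
      using k by simp
  qed
  have "P E"
    unfolding P_def
  proof (intro conjI allI impI ballI)
    show "Vector_Spaces.linear scale scale E" by fact
    have multiple: "\<exists>c. E v = scale c (u k)" for v
    proof -
      obtain g where "v = (\<Sum>i\<le>d. scale (g i) (u i))"
        using indexed_basis_coords[OF ib] by metis
      then show ?thesis
        using E_sum by blast
    qed
    show "E (E v) = E v" for v
    proof -
      obtain c where "E v = scale c (u k)"
        using multiple by blast
      then show ?thesis
        using k by (simp add: E.scale E_u)
    qed
    have "E v \<in> range (\<lambda>c. scale c (u k))" for v
      using multiple[of v] by auto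
    moreover have "scale c (u k) \<in> range E" for c
      using E.scale[of c "u k"] E_u[OF k] by (metis rangeI)
    ultimately show "range E = eigenspace scale T (l k)"
      unfolding eigenspace_eigenbasis[OF eb k] by auto
  next
    fix \<mu> v assume \<mu>: "\<mu> \<noteq> l k" and "v \<in> eigenspace scale T \<mu>"
    then have v: "T v = scale \<mu> v"
      by (simp add: eigenspace_def)
    obtain g where g: "v = (\<Sum>i\<le>d. scale (g i) (u i))"
      using indexed_basis_coords[OF ib] by metis
    then show "E v = 0"
      using eigenbasis_eigenvector_coeff[OF eb v g k] \<mu> E_sum by auto
  qed
  moreover have "F = E" if "P F" for F
  proof
    fix x
    have "F y = E y" if "y \<in> u ` {..d}" for y
      using that P_val[OF \<open>P F\<close>] P_val[OF \<open>P E\<close>] by auto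
    then show "F x = E x"
      using that E span by (intro linear_eq_on[of F E x "u ` {..d}"]) (auto simp: P_def)
  qed
  ultimately have "P (prim_idem scale T (l k))"
    unfolding prim_idem_def P_def[symmetric] by (rule theI)
  then show ?lin ?ran "j \<le> d \<Longrightarrow> ?val"
    using P_val by (auto simp: P_def)
qed

end

section \<open>Operator triples with the defining relations, and their eigenvalues\<close>

definition anticomm_triple ::
  "('k::field \<Rightarrow> 'v::ab_group_add \<Rightarrow> 'v) \<Rightarrow> ('v \<Rightarrow> 'v) \<Rightarrow> ('v \<Rightarrow> 'v) \<Rightarrow> ('v \<Rightarrow> 'v) \<Rightarrow> bool"
where
  "anticomm_triple scale A B C \<longleftrightarrow>
     Vector_Spaces.linear scale scale A \<and> Vector_Spaces.linear scale scale B \<and>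
     Vector_Spaces.linear scale scale C \<and>
     (\<forall>v. A (B v) + B (A v) = C v + C v) \<and>
     (\<forall>v. B (C v) + C (B v) = A v + A v) \<and>
     (\<forall>v. C (A v) + A (C v) = B v + B v)"

lemma anticomm_triple_swap12: "anticomm_triple scale A B C \<Longrightarrow> anticomm_triple scale B A C"
  and anticomm_triple_swap23: "anticomm_triple scale A B C \<Longrightarrow> anticomm_triple scale A C B"
  by (auto simp: anticomm_triple_def add.commute)

text \<open>The eigenvalues \<open>eigval\<close> with the sign \<open>hat\<close> removed. The
  formula is also used at \<open>d + 1\<close>, where it takes the same value as at
  \<open>d\<close>.\<close>

definition AB_eigval :: "nat \<Rightarrow> nat \<Rightarrow> 'k::field" where
  "AB_eigval d i = (- 1) ^ (d + i) * (2 * of_nat d - 2 * of_nat i + 1)"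

text \<open>\<open>prev v 0 = 0\<close> encodes the convention \<open>v\<^bsub>-1\<^esub> = 0\<close>; \<open>AB_sequence\<close> stores \<open>v\<^bsub>d+1\<^esub> = v\<^bsub>d\<^esub>\<close>.\<close>

definition prev :: "(nat \<Rightarrow> 'v::zero) \<Rightarrow> nat \<Rightarrow> 'v" where
  "prev v i = (case i of 0 \<Rightarrow> 0 | Suc j \<Rightarrow> v j)"

lemma prev_simps [simp]: "prev v 0 = 0" "prev v (Suc i) = v i"
  by (simp_all add: prev_def)

definition AB_sequence ::
  "('k::field \<Rightarrow> 'v::ab_group_add \<Rightarrow> 'v) \<Rightarrow> nat \<Rightarrow> ('v \<Rightarrow> 'v) \<Rightarrow> ('v \<Rightarrow> 'v) \<Rightarrow> ('v \<Rightarrow> 'v) \<Rightarrow>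
   (nat \<Rightarrow> 'v) \<Rightarrow> bool" where
  "AB_sequence scale d A B C v \<longleftrightarrow> indexed_basis scale d v \<and> v (Suc d) = v d \<and>
     (\<forall>i\<le>d. A (v i) = scale (AB_eigval d i) (v i) \<and>
        B (v i) = scale ((- 1) ^ d * (2 * of_nat d - of_nat i + 2)) (prev v i) +
                  scale ((- 1) ^ d * (of_nat i + 1)) (v (Suc i)) \<and>
        C (v i) = scale (- ((- 1) ^ i * (2 * of_nat d - of_nat i + 2))) (prev v i) +
                  scale ((- 1) ^ i * (of_nat i + 1)) (v (Suc i)))"

lemma minus_one_power_square [simp]: "(- 1 :: 'k::comm_ring_1) ^ n * (- 1) ^ n = 1"
  by (simp flip: power_mult_distrib)

lemma minus_one_power_mult_add:
  "(- 1 :: 'k::comm_ring_1) ^ m * (- 1) ^ (m + n) = (- 1) ^ n"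
  by (simp add: power_add flip: mult.assoc)

text \<open>Squaring removes the signs and leaves the squares of the odd numbers
  \<open>2 * d - 2 * i + 1\<close>, which are positive and distinct for \<open>i \<le> d\<close>;
  characteristic zero allows the comparison to be made in the integers.\<close>

lemma AB_eigval_abs_cases:
  assumes "AB_eigval d i = (AB_eigval d j :: 'k::field_char_0) \<or> AB_eigval d i = - (AB_eigval d j :: 'k)"
    and "i \<le> d" and "j \<le> d"
  shows "i = j"
proof -
  define t :: "nat \<Rightarrow> int" where "t m = 2 * int d - 2 * int m + 1" for m
  have sq: "(AB_eigval d m :: 'k) ^ 2 = of_int ((t m)\<^sup>2)" for m
    by (simp add: AB_eigval_def t_def power_mult_distrib flip: power_mult)
  have "(AB_eigval d i :: 'k) ^ 2 = (AB_eigval d j) ^ 2"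
    using assms(1) by auto
  then have "(t i)\<^sup>2 = (t j)\<^sup>2"
    unfolding sq by (simp only: of_int_eq_iff)
  then have "t i = t j"
    using assms(2,3) by (auto simp: power2_eq_iff t_def)
  then show ?thesis
    by (simp add: t_def)
qed

lemma inj_on_AB_eigval: "inj_on (AB_eigval d :: nat \<Rightarrow> 'k::field_char_0) {..d}"
  by (auto intro!: inj_onI AB_eigval_abs_cases)

text \<open>Comparing absolute values would force \<open>i = 0\<close>, and then
  \<open>2 * d + 1 = 0\<close>. This later excludes the wrong sign at the boundary.\<close>

lemma AB_eigval_uminus_ne:
  assumes "i \<le> d"
  shows "AB_eigval d i \<noteq> - (AB_eigval d 0 :: 'k::field_char_0)"
proof
  assume *: "AB_eigval d i = - (AB_eigval d 0 :: 'k)"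
  then have "i = 0"
    using AB_eigval_abs_cases assms by blast
  with * have "(of_nat (2 * d + 1) :: 'k) = 0"
    by (simp add: AB_eigval_def eq_neg_iff_add_eq_0 flip: mult_2) (simp add: add.commute)
  then show False
    by (simp only: of_nat_eq_0_iff)
qed

text \<open>Matches the eigenvalue shift \<open>2 * e - t\<close> of
  \<open>anticomm_triple_raise_eigen\<close> for \<open>e = (- 1) ^ (d + i)\<close>.\<close>

lemma AB_eigval_Suc: "AB_eigval d (Suc i) = 2 * (- 1) ^ (d + i) - AB_eigval d i"
  by (simp add: AB_eigval_def algebra_simps)

locale vector_space_char_0 = vector_space scale
  for scale :: "'k::field_char_0 \<Rightarrow> 'v::ab_group_add \<Rightarrow> 'v" (infixr "*s" 75)
begin

lemma AB_sequence_eigenbasis: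
  assumes "anticomm_triple scale A B C" and "AB_sequence scale d A B C v"
  shows "eigenbasis scale A (AB_eigval d) d v"
  using assms by (simp add: anticomm_triple_def AB_sequence_def eigenbasis_def inj_on_AB_eigval)

lemma AB_sequence_scale:
  assumes tr: "anticomm_triple scale A B C" and v: "AB_sequence scale d A B C v" and "k \<noteq> 0"
  shows "AB_sequence scale d A B C (\<lambda>i. k *s v i)"
proof -
  interpret A: Vector_Spaces.linear scale scale A using tr by (simp add: anticomm_triple_def)
  interpret B: Vector_Spaces.linear scale scale B using tr by (simp add: anticomm_triple_def)
  interpret C: Vector_Spaces.linear scale scale C using tr by (simp add: anticomm_triple_def)
  have "indexed_basis scale d (\<lambda>i. k *s v i)"
    by (rule indexed_basis_rescale[of d v "\<lambda>_. k"]) (use v \<open>k \<noteq> 0\<close> in \<open>auto simp: AB_sequence_def\<close>)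
  moreover have "prev (\<lambda>i. k *s v i) i = k *s prev v i" for i
    by (cases i) auto
  ultimately show ?thesis
    using v unfolding AB_sequence_def
    by (simp add: A.scale B.scale C.scale scale_right_distrib scale_left_commute[of _ k]
        del: scale_scale scale_minus_left)
qed

text \<open>\<open>B\<close> and \<open>C\<close> send \<open>v i\<close> to combinations of the
  same two neighbours, with coefficients that differ only in sign. Signs on the basis vectors
  convert one pattern into the other and keep them eigenvectors of \<open>A\<close>.\<close>

lemma AB_sequence_swap23:
  assumes tr: "anticomm_triple scale A B C" and v: "AB_sequence scale d A B C v"
  shows "\<exists>w. AB_sequence scale d A C B w"
proof -
  interpret A: Vector_Spaces.linear scale scale A using tr by (simp add: anticomm_triple_def)
  interpret B: Vector_Spaces.linear scale scale B using tr by (simp add: anticomm_triple_def)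
  interpret C: Vector_Spaces.linear scale scale C using tr by (simp add: anticomm_triple_def)
  \<comment> \<open>The ratio of consecutive factors is the quotient of the coefficients of
    \<open>v (Suc i)\<close> in \<open>B (v i)\<close> and \<open>C (v i)\<close>.\<close>
  define s :: "nat \<Rightarrow> 'k" where "s i = (\<Prod>j<i. (- 1) ^ (d + j))" for i
  have s_Suc: "s (Suc i) = (- 1) ^ (d + i) * s i" for i
    by (simp add: s_def mult.commute)
  have s_sq: "s i * s i = 1" for i
    by (induction i) (simp_all add: s_Suc s_def algebra_simps)
  have nz: "s i \<noteq> 0" for i
    using s_sq[of i] by auto
  define w where "w i = s i *s v (min i d)" for i
  have w: "w i = s i *s v i" if "i \<le> Suc d" for i
    using that v by (cases "i = Suc d") (auto simp: w_def AB_sequence_def)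
  have ib: "indexed_basis scale d w"
    by (rule indexed_basis_rescale[of d v s]) (use v nz w in \<open>auto simp: AB_sequence_def\<close>)
  \<comment> \<open>At \<open>i = d\<close> the ratio is \<open>(- 1) ^ (d + d) = 1\<close>, so the
    signs respect the boundary convention.\<close>
  have last: "w (Suc d) = w d"
    by (simp add: w_def s_Suc power_add)
  have Suc_w: "s i *s v (Suc i) = (- 1) ^ (d + i) *s w (Suc i)" if "i \<le> d" for i
    using that by (simp add: w s_Suc flip: mult.assoc)
  have prev_w: "s i *s prev v i = (- ((- 1) ^ (d + i))) *s prev w i" if "i \<le> d" for i
    using that by (cases i) (auto simp: w s_Suc)
  have scale_swap: "s i *s (e *s x) = e *s (s i *s x)" for i e x
    by (simp add: mult.commute)
  have "A (w i) = AB_eigval d i *s w i \<and>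
        C (w i) = ((- 1) ^ d * (2 * of_nat d - of_nat i + 2)) *s prev w i +
                  ((- 1) ^ d * (of_nat i + 1)) *s w (Suc i) \<and>
        B (w i) = (- ((- 1) ^ i * (2 * of_nat d - of_nat i + 2))) *s prev w i +
                  ((- 1) ^ i * (of_nat i + 1)) *s w (Suc i)" if "i \<le> d" for i
  proof (intro conjI)
    have Av: "A (v i) = AB_eigval d i *s v i"
      and Bv: "B (v i) = ((- 1) ^ d * (2 * of_nat d - of_nat i + 2)) *s prev v i +
                  ((- 1) ^ d * (of_nat i + 1)) *s v (Suc i)"
      and Cv: "C (v i) = (- ((- 1) ^ i * (2 * of_nat d - of_nat i + 2))) *s prev v i +
                  ((- 1) ^ i * (of_nat i + 1)) *s v (Suc i)"
      using v that unfolding AB_sequence_def by blast+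
    show "A (w i) = AB_eigval d i *s w i"
      using that by (simp add: w A.scale Av mult.commute)
    have signs: "(- 1) ^ i * (- 1) ^ (d + i) = (- 1 :: 'k) ^ d" "(- 1) ^ d * (- 1) ^ (d + i) = (- 1 :: 'k) ^ i"
      using minus_one_power_mult_add[of i d] minus_one_power_mult_add[of d i]
      by (simp_all add: add.commute)
    have "C (w i) = (- ((- 1) ^ i * (2 * of_nat d - of_nat i + 2))) *s (s i *s prev v i) +
                  ((- 1) ^ i * (of_nat i + 1)) *s (s i *s v (Suc i))"
      using that by (simp only: w C.scale Cv scale_right_distrib scale_swap)
    also have "\<dots> = ((- 1) ^ i * (- 1) ^ (d + i) * (2 * of_nat d - of_nat i + 2)) *s prev w i +
                  ((- 1) ^ i * (- 1) ^ (d + i) * (of_nat i + 1)) *s w (Suc i)"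
      unfolding Suc_w[OF that] prev_w[OF that] scale_scale by (simp add: mult_ac)
    finally show "C (w i) = ((- 1) ^ d * (2 * of_nat d - of_nat i + 2)) *s prev w i +
                  ((- 1) ^ d * (of_nat i + 1)) *s w (Suc i)"
      unfolding signs .
    have "B (w i) = ((- 1) ^ d * (2 * of_nat d - of_nat i + 2)) *s (s i *s prev v i) +
                  ((- 1) ^ d * (of_nat i + 1)) *s (s i *s v (Suc i))"
      using that by (simp only: w B.scale Bv scale_right_distrib scale_swap)
    also have "\<dots> = (- ((- 1) ^ d * (- 1) ^ (d + i) * (2 * of_nat d - of_nat i + 2))) *s prev w i +
                  ((- 1) ^ d * (- 1) ^ (d + i) * (of_nat i + 1)) *s w (Suc i)"
      unfolding Suc_w[OF that] prev_w[OF that] scale_scale by (simp add: mult_ac)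
    finally show "B (w i) = (- ((- 1) ^ i * (2 * of_nat d - of_nat i + 2))) *s prev w i +
                  ((- 1) ^ i * (of_nat i + 1)) *s w (Suc i)"
      unfolding signs .
  qed
  then show ?thesis
    using ib last unfolding AB_sequence_def by blast
qed

section \<open>Exchanging the first two operators of a triple\<close>

lemma sum_prev_Suc:
  assumes "\<beta> 0 = 0"
  shows "(\<Sum>i\<le>d. \<alpha> i *s prev v i + \<beta> (Suc i) *s v (Suc i)) =
    (\<Sum>i\<le>d. (\<alpha> (Suc i) + \<beta> i) *s v i) - \<alpha> (Suc d) *s v d + \<beta> (Suc d) *s v (Suc d)"
  by (induction d) (simp_all add: assms algebra_simps scale_left_distrib)

text \<open>Collecting the coefficient of each \<open>v i\<close> gives row sums: for
  \<open>B\<close> they all equal \<open>(- 1) ^ d * (2 * d + 1)\<close>, for \<open>C\<close> they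
  are \<open>(- 1) ^ d\<close> times the eigenvalues of \<open>A\<close>. By the second identity
  \<open>A - (- 1) ^ d C\<close> annihilates the sum, which makes it the bottom of a chain of
  \<open>B\<close>-eigenvectors.\<close>

lemma AB_sequence_sum:
  assumes v: "AB_sequence scale d A B C v" and tr: "anticomm_triple scale A B C"
  shows "B (\<Sum>i\<le>d. v i) = AB_eigval d 0 *s (\<Sum>i\<le>d. v i)"
    and "C (\<Sum>i\<le>d. v i) = (- 1) ^ d *s A (\<Sum>i\<le>d. v i)"
proof -
  interpret A: Vector_Spaces.linear scale scale A using tr by (simp add: anticomm_triple_def)
  interpret B: Vector_Spaces.linear scale scale B using tr by (simp add: anticomm_triple_def)
  interpret C: Vector_Spaces.linear scale scale C using tr by (simp add: anticomm_triple_def)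
  have last: "v (Suc d) = v d"
    using v by (simp add: AB_sequence_def)
  define \<alpha> \<beta> :: "nat \<Rightarrow> 'k" where "\<alpha> i = (- 1) ^ d * (2 * of_nat d - of_nat i + 2)"
    and "\<beta> i = (- 1) ^ d * of_nat i" for i
  have "B (\<Sum>i\<le>d. v i) = (\<Sum>i\<le>d. \<alpha> i *s prev v i + \<beta> (Suc i) *s v (Suc i))"
    using v by (simp add: B.sum AB_sequence_def \<alpha>_def \<beta>_def add.commute)
  \<comment> \<open>The two boundary terms of \<open>sum_prev_Suc\<close> cancel, because
    \<open>v (Suc d) = v d\<close> and \<open>\<alpha> (Suc d) = \<beta> (Suc d)\<close>. The same
    happens below with \<open>\<gamma>\<close> and \<open>\<delta>\<close>.\<close>
  also have "\<dots> = (\<Sum>i\<le>d. (\<alpha> (Suc i) + \<beta> i) *s v i)"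
    by (subst sum_prev_Suc) (simp_all add: last \<alpha>_def \<beta>_def algebra_simps)
  also have "\<dots> = (\<Sum>i\<le>d. AB_eigval d 0 *s v i)"
    by (simp add: \<alpha>_def \<beta>_def AB_eigval_def algebra_simps)
  finally show "B (\<Sum>i\<le>d. v i) = AB_eigval d 0 *s (\<Sum>i\<le>d. v i)"
    by (simp add: scale_sum_right)
  define \<gamma> \<delta> :: "nat \<Rightarrow> 'k" where "\<gamma> i = - ((- 1) ^ i * (2 * of_nat d - of_nat i + 2))"
    and "\<delta> i = - ((- 1) ^ i * of_nat i)" for i
  have coeff: "\<gamma> (Suc i) + \<delta> i = (- 1) ^ d * AB_eigval d i" for i
    unfolding AB_eigval_def mult.assoc[symmetric] minus_one_power_mult_add
    by (simp add: \<gamma>_def \<delta>_def algebra_simps)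
  have "C (\<Sum>i\<le>d. v i) = (\<Sum>i\<le>d. \<gamma> i *s prev v i + \<delta> (Suc i) *s v (Suc i))"
    using v by (simp add: C.sum AB_sequence_def \<gamma>_def \<delta>_def add.commute)
  also have "\<dots> = (\<Sum>i\<le>d. (\<gamma> (Suc i) + \<delta> i) *s v i)"
    by (subst sum_prev_Suc) (simp_all add: last \<gamma>_def \<delta>_def algebra_simps)
  also have "\<dots> = (- 1) ^ d *s A (\<Sum>i\<le>d. v i)"
    unfolding coeff using v by (simp add: A.sum AB_sequence_def scale_sum_right)
  finally show "C (\<Sum>i\<le>d. v i) = (- 1) ^ d *s A (\<Sum>i\<le>d. v i)" .
qed

text \<open>The relations give \<open>B (A v) = 2 C v - t A v\<close> and
  \<open>B (C v) = 2 A v - t C v\<close>; as \<open>e\<close> is its own inverse, the combination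
  with coefficient \<open>e\<close> diagonalizes this symmetric pattern.\<close>

lemma anticomm_triple_raise_eigen:
  assumes tr: "anticomm_triple scale A B C" and e: "e * e = 1" and v: "B v = t *s v"
  shows "B (A v + e *s C v) = (2 * e - t) *s (A v + e *s C v)"
proof -
  interpret A: Vector_Spaces.linear scale scale A using tr by (simp add: anticomm_triple_def)
  interpret B: Vector_Spaces.linear scale scale B using tr by (simp add: anticomm_triple_def)
  interpret C: Vector_Spaces.linear scale scale C using tr by (simp add: anticomm_triple_def)
  have twice: "x + x = 2 *s x" for x
    using scale_left_distrib[of 1 1 x] by simp
  have "B (A v) = C v + C v - A (B v)" "B (C v) = A v + A v - C (B v)"
    using tr by (simp_all add: anticomm_triple_def eq_diff_eq add.commute)
  then have BAC: "B (A v) = 2 *s C v - t *s A v" "B (C v) = 2 *s A v - t *s C v"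
    by (simp_all only: v A.scale C.scale twice)
  have "B (A v + e *s C v) = (2 * e - t) *s A v + (2 - e * t) *s C v"
    unfolding B.add B.scale BAC
    by (simp add: scale_right_diff_distrib scale_left_diff_distrib algebra_simps)
  also have "2 - e * t = (2 * e - t) * e"
    using e by (simp add: algebra_simps)
  finally show ?thesis
    by (simp add: scale_right_distrib)
qed

text \<open>Moving \<open>A\<close> past \<open>B\<^sup>2\<close> and past \<open>C\<^sup>2\<close>
  produces opposite multiples of the commutator of \<open>B\<close> and \<open>C\<close>, which
  cancel. Commutation with the other operators comes from permuting the triple.\<close>

lemma anticomm_triple_casimir_commute:
  assumes tr: "anticomm_triple scale A B C"
  shows "A (A (A v) + B (B v) + C (C v)) = A (A (A v)) + B (B (A v)) + C (C (A v))"
proof -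
  interpret A: Vector_Spaces.linear scale scale A using tr by (simp add: anticomm_triple_def)
  interpret B: Vector_Spaces.linear scale scale B using tr by (simp add: anticomm_triple_def)
  interpret C: Vector_Spaces.linear scale scale C using tr by (simp add: anticomm_triple_def)
  have AB: "A (B w) = C w + C w - B (A w)" and AC: "A (C w) = B w + B w - C (A w)" for w
    using tr by (simp_all add: anticomm_triple_def eq_diff_eq add.commute)
  show ?thesis
    by (simp add: AB AC A.add B.add B.diff C.add C.diff)
qed

text \<open>In the expanded square of \<open>A + e C\<close>, the term \<open>A C + C A\<close>
  becomes \<open>2 B\<close>, and \<open>A\<^sup>2 + C\<^sup>2\<close> is the central element minus
  \<open>B\<^sup>2\<close>. This yields the factor by which a raised vector is lowered back.\<close>

lemma anticomm_triple_raise_raise: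
  assumes tr: "anticomm_triple scale A B C" and e: "e * e = 1" and v: "B v = t *s v"
  shows "A (A v + e *s C v) + e *s C (A v + e *s C v) =
    A (A v) + B (B v) + C (C v) + (2 * e * t - t * t) *s v"
proof -
  interpret A: Vector_Spaces.linear scale scale A using tr by (simp add: anticomm_triple_def)
  interpret B: Vector_Spaces.linear scale scale B using tr by (simp add: anticomm_triple_def)
  interpret C: Vector_Spaces.linear scale scale C using tr by (simp add: anticomm_triple_def)
  have "A (A v + e *s C v) + e *s C (A v + e *s C v) =
      A (A v) + e *s (C (A v) + A (C v)) + (e * e) *s C (C v)"
    by (simp add: A.add A.scale C.add C.scale scale_right_distrib)
  also have "C (A v) + A (C v) = B v + B v"
    using tr by (simp add: anticomm_triple_def)
  also have "A (A v) + e *s (B v + B v) + (e * e) *s C (C v) =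
      (A (A v) + B (B v) + C (C v)) - B (B v) + e *s (B v + B v)"
    by (simp add: e)
  also have "\<dots> = A (A v) + B (B v) + C (C v) + (2 * e * t - t * t) *s v"
  proof -
    have "e *s (B v + B v) = (2 * e * t) *s v"
      by (simp only: v scale_right_distrib scale_scale mult_2 distrib_right scale_left_distrib)
    then show ?thesis
      unfolding scale_left_diff_distrib by (simp add: v B.scale)
  qed
  finally show ?thesis .
qed

lemma AB_sequence_swap12:
  assumes tr: "anticomm_triple scale A B C" and v: "AB_sequence scale d A B C v"
  shows "\<exists>w. AB_sequence scale d B A C w"
proof -
  interpret A: Vector_Spaces.linear scale scale A using tr by (simp add: anticomm_triple_def)
  interpret B: Vector_Spaces.linear scale scale B using tr by (simp add: anticomm_triple_def)
  interpret C: Vector_Spaces.linear scale scale C using tr by (simp add: anticomm_triple_def)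
  \<comment> \<open>On \<open>B\<close>-eigenvectors for \<open>\<theta> i\<close>,
    \<open>A + e i C\<close> raises the index and \<open>A - e i C\<close> lowers it.\<close>
  define e :: "nat \<Rightarrow> 'k" where "e i = (- 1) ^ (d + i)" for i
  have e_sq: "e i * e i = 1" and e_Suc: "e (Suc i) = - e i" for i
    by (simp_all add: e_def)
  define \<theta> :: "nat \<Rightarrow> 'k" where "\<theta> = AB_eigval d"
  define q :: "nat \<Rightarrow> 'k" where "q i = 2 * of_nat d - 2 * of_nat i + 1" for i
  have \<theta>_e: "\<theta> i = e i * q i" for i
    by (simp add: \<theta>_def e_def q_def AB_eigval_def)
  have e_\<theta>: "e i * \<theta> i = q i" and \<theta>_sq: "\<theta> i * \<theta> i = q i * q i" for i
    using e_sq[of i] by (simp_all add: \<theta>_e mult.assoc[symmetric] mult.left_commute[of _ "e i"])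
  define h :: 'k where "h = (- 1) ^ d"
  have h_sq: "h * h = 1" and h0: "h \<noteq> 0"
    by (simp_all add: h_def)
  \<comment> \<open>The factor makes raising \<open>w i\<close> give exactly
    \<open>2 * h * (of_nat i + 1)\<close> times \<open>w (Suc i)\<close>, twice the coefficient
    wanted for \<open>A\<close>. The chain continues past \<open>d\<close>, since the boundary
    condition concerns \<open>w (Suc d)\<close>.\<close>
  define w where "w = rec_nat (\<Sum>i\<le>d. v i)
    (\<lambda>i x. (h / (2 * (of_nat i + 1))) *s (A x + e i *s C x))"
  have w_0: "w 0 = (\<Sum>i\<le>d. v i)"
    and w_Suc: "w (Suc i) = (h / (2 * (of_nat i + 1))) *s (A (w i) + e i *s C (w i))" for i
    by (simp_all add: w_def)
  have of_nat_Suc_ne: "of_nat i + 1 \<noteq> (0 :: 'k)" for i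
    using of_nat_neq_0[of i] by (simp add: add.commute)
  have up: "A (w i) + e i *s C (w i) = (2 * h * (of_nat i + 1)) *s w (Suc i)" for i
  proof -
    have "2 * h * x * (h / (2 * x)) = h * h" if "x \<noteq> 0" for x
      using that by simp
    from this[OF of_nat_Suc_ne[of i]]
    have "2 * h * (of_nat i + 1) * (h / (2 * (of_nat i + 1))) = 1"
      unfolding h_sq .
    then show ?thesis
      unfolding w_Suc scale_scale by simp
  qed
  have Bw: "B (w i) = \<theta> i *s w i" for i
  proof (induction i)
    case 0
    then show ?case
      using AB_sequence_sum(1)[OF v tr] by (simp add: w_0 \<theta>_def)
  next
    case (Suc i)
    then show ?case
      unfolding w_Suc B.scale anticomm_triple_raise_eigen[OF tr e_sq Suc]
      by (simp add: \<theta>_def AB_eigval_Suc e_def mult.commute)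
  qed
  have down_0: "A (w 0) - e 0 *s C (w 0) = 0"
    using AB_sequence_sum(2)[OF v tr] by (simp add: w_0 e_def)
  define \<Omega> where "\<Omega> x = A (A x) + B (B x) + C (C x)" for x
  have \<Omega>_add: "\<Omega> (x + y) = \<Omega> x + \<Omega> y" and \<Omega>_scale: "\<Omega> (r *s x) = r *s \<Omega> x" for x y r
    by (simp_all add: \<Omega>_def A.add B.add C.add A.scale B.scale C.scale scale_right_distrib)
  have \<Omega>_A: "\<Omega> (A x) = A (\<Omega> x)" for x
    unfolding \<Omega>_def by (rule anticomm_triple_casimir_commute[OF tr, symmetric])
  have "anticomm_triple scale C B A"
    using tr by (blast intro: anticomm_triple_swap12 anticomm_triple_swap23)
  from anticomm_triple_casimir_commute[OF this] have \<Omega>_C: "\<Omega> (C x) = C (\<Omega> x)" for x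
    unfolding \<Omega>_def by (simp add: add_ac)
  \<comment> \<open>The scalar by which \<open>\<Omega>\<close> acts: lowering \<open>w 0\<close>
    gives zero, so the squared shift with sign \<open>- e 0\<close> yields
    \<open>\<theta> 0 * \<theta> 0 + 2 * e 0 * \<theta> 0\<close>. Centrality spreads this value
    along the chain.\<close>
  define \<omega> :: 'k where "\<omega> = q 0 * q 0 + 2 * q 0"
  have \<Omega>w: "\<Omega> (w i) = \<omega> *s w i" for i
  proof (induction i)
    case 0
    have "A (w 0) + (- e 0) *s C (w 0) = 0"
      using down_0 by simp
    moreover have "(- e 0) * (- e 0) = 1"
      using e_sq by simp
    ultimately have "\<Omega> (w 0) + (2 * (- e 0) * \<theta> 0 - \<theta> 0 * \<theta> 0) *s w 0 = 0"
      using anticomm_triple_raise_raise[OF tr _ Bw, of "- e 0" 0]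
      unfolding \<Omega>_def[symmetric] by (simp add: A.zero C.zero)
    moreover have "2 * (- e 0) * \<theta> 0 - \<theta> 0 * \<theta> 0 = - \<omega>"
      using e_\<theta>[of 0] \<theta>_sq[of 0] by (simp add: \<omega>_def mult.assoc)
    ultimately show ?case
      by simp
  next
    case (Suc i)
    then show ?case
      unfolding w_Suc
      by (simp add: \<Omega>_add \<Omega>_scale \<Omega>_A \<Omega>_C A.scale C.scale scale_right_distrib mult_ac)
  qed
  have down_Suc: "A (w (Suc i)) + e i *s C (w (Suc i)) = (2 * h * (2 * of_nat d - of_nat i + 1)) *s w i" for i
  proof -
    define r where "r = h / (2 * (of_nat i + 1))"
    have "A (r *s y) + e i *s C (r *s y) = r *s (A y + e i *s C y)" for y
      by (simp add: A.scale C.scale scale_right_distrib mult.commute)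
    then have "A (w (Suc i)) + e i *s C (w (Suc i)) =
        r *s (A (A (w i) + e i *s C (w i)) + e i *s C (A (w i) + e i *s C (w i)))"
      unfolding w_Suc r_def[symmetric] .
    also have "\<dots> = (r * (\<omega> + (2 * e i * \<theta> i - \<theta> i * \<theta> i))) *s w i"
      unfolding anticomm_triple_raise_raise[OF tr e_sq Bw] \<Omega>_def[symmetric] \<Omega>w
      by (simp add: scale_left_distrib scale_right_distrib distrib_left)
    \<comment> \<open>The left side is the difference of squares
      \<open>(q 0 + 1)\<^sup>2 - (q i - 1)\<^sup>2\<close>.\<close>
    also have "\<omega> + (2 * e i * \<theta> i - \<theta> i * \<theta> i) = 4 * (of_nat i + 1) * (2 * of_nat d - of_nat i + 1)"
      unfolding \<theta>_sq mult.assoc e_\<theta> by (simp add: \<omega>_def q_def algebra_simps)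
    also have "r * (4 * (of_nat i + 1) * (2 * of_nat d - of_nat i + 1)) =
        2 * h * (2 * of_nat d - of_nat i + 1)"
    proof -
      have "h / (2 * x) * (4 * x * y) = 2 * h * y" if "x \<noteq> 0" for x y
        using that by simp
      then show ?thesis
        unfolding r_def using of_nat_Suc_ne by blast
    qed
    finally show ?thesis .
  qed
  \<comment> \<open>Since \<open>e (Suc i) = - e i\<close>, the operator in \<open>down_Suc\<close>
    is the lowering operator at index \<open>Suc i\<close>.\<close>
  have down: "A (w i) - e i *s C (w i) = (2 * h * (2 * of_nat d - of_nat i + 2)) *s prev w i" for i
    using down_0 down_Suc by (cases i) (simp_all add: e_Suc)
  have halve: "x = y" if "x + x = y + y" for x y :: 'v
  proof -
    have "(2 :: 'k) *s x = 2 *s y"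
      using that scale_left_distrib[of 1 1 x] scale_left_distrib[of 1 1 y] by simp
    then show ?thesis
      by simp
  qed
  have double: "(2 * h * y) *s x = (h * y) *s x + (h * y) *s x" for x y
    by (simp only: mult_2 distrib_right scale_left_distrib)
  \<comment> \<open>\<open>A\<close> is half the sum of the raising and lowering operators;
    \<open>C\<close> is then read off from the raising operator, using
    \<open>e i * e i = 1\<close>.\<close>
  have Aw: "A (w i) = (h * (2 * of_nat d - of_nat i + 2)) *s prev w i + (h * (of_nat i + 1)) *s w (Suc i)" for i
  proof (rule halve)
    have "A (w i) + A (w i) = (A (w i) - e i *s C (w i)) + (A (w i) + e i *s C (w i))"
      by simp
    then show "A (w i) + A (w i) =
        (h * (2 * of_nat d - of_nat i + 2)) *s prev w i + (h * (of_nat i + 1)) *s w (Suc i) +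
        ((h * (2 * of_nat d - of_nat i + 2)) *s prev w i + (h * (of_nat i + 1)) *s w (Suc i))"
      unfolding up down double by (simp add: add_ac)
  qed
  have Cw: "C (w i) = (- ((- 1) ^ i * (2 * of_nat d - of_nat i + 2))) *s prev w i +
      ((- 1) ^ i * (of_nat i + 1)) *s w (Suc i)" for i
  proof -
    have "e i *s C (w i) = (2 * h * (of_nat i + 1)) *s w (Suc i) - A (w i)"
      unfolding up[symmetric] by simp
    also have "\<dots> = (- (h * (2 * of_nat d - of_nat i + 2))) *s prev w i + (h * (of_nat i + 1)) *s w (Suc i)"
      unfolding Aw double by simp
    finally have "e i *s (e i *s C (w i)) =
        e i *s ((- (h * (2 * of_nat d - of_nat i + 2))) *s prev w i + (h * (of_nat i + 1)) *s w (Suc i))"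
      by simp
    then have "C (w i) = (- (e i * h * (2 * of_nat d - of_nat i + 2))) *s prev w i +
        (e i * h * (of_nat i + 1)) *s w (Suc i)"
      by (simp add: e_sq scale_right_distrib scale_right_diff_distrib mult.assoc)
    also have "e i * h = (- 1) ^ i"
      using minus_one_power_mult_add[of d i] by (simp add: e_def h_def mult.commute)
    finally show ?thesis .
  qed
  \<comment> \<open>Lowering recovers \<open>w i\<close> from \<open>w (Suc i)\<close> up to a
    nonzero factor, so a vanishing vector would make its predecessor vanish too.\<close>
  have w_nz: "w i \<noteq> 0" if "i \<le> d" for i
    using that
  proof (induction i)
    case 0
    then show ?case
      using v indexed_basis_sum_nonzero by (simp add: w_0 AB_sequence_def)
  next
    case (Suc i)
    have "2 * of_nat d - of_nat i + 1 = (of_nat (2 * d - i + 1) :: 'k)"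
      using Suc.prems by (simp add: of_nat_diff)
    then have "2 * of_nat d - of_nat i + 1 \<noteq> (0 :: 'k)"
      by (metis add.commute of_nat_neq_0 plus_1_eq_Suc)
    then show ?case
      using Suc down_Suc[of i] h0 by (auto simp: A.zero C.zero)
  qed
  have lin_B: "Vector_Spaces.linear scale scale B"
    using tr by (simp add: anticomm_triple_def)
  have inj_\<theta>: "inj_on \<theta> {..d}"
    by (simp add: \<theta>_def inj_on_AB_eigval)
  have "indexed_basis scale d v"
    using v by (simp add: AB_sequence_def)
  then have "indexed_basis scale d w"
    using eigenvectors_indexed_independent[OF lin_B inj_\<theta> Bw w_nz]
    by (rule indexed_basis_if_independent)
  then have eb: "eigenbasis scale B \<theta> d w"
    using Bw lin_B inj_\<theta> by (simp add: eigenbasis_def)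
  \<comment> \<open>Both values are \<open>1\<close>, so \<open>w (Suc d)\<close> falls into the
    line spanned by \<open>w d\<close>.\<close>
  have "\<theta> (Suc d) = \<theta> d"
    by (simp add: \<theta>_def AB_eigval_def)
  then have "w (Suc d) \<in> eigenspace scale B (\<theta> d)"
    using Bw[of "Suc d"] by (simp add: eigenspace_def)
  then obtain \<kappa> where \<kappa>: "w (Suc d) = \<kappa> *s w d"
    unfolding eigenspace_eigenbasis[OF eb order_refl] by blast
  \<comment> \<open>At \<open>i = d\<close> the coefficients in \<open>up\<close> and
    \<open>down_Suc\<close> coincide: \<open>A + e d C\<close> sends \<open>w d\<close> to
    \<open>m *s w (Suc d)\<close> and \<open>w (Suc d)\<close> to \<open>m *s w d\<close>, whence
    \<open>\<kappa>\<close> squares to \<open>1\<close>.\<close>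
  define m where "m = 2 * h * (of_nat d + 1)"
  have "m \<noteq> 0"
    using h0 of_nat_Suc_ne by (simp add: m_def)
  have "m *s w d = A (w (Suc d)) + e d *s C (w (Suc d))"
    unfolding down_Suc by (simp add: m_def)
  also have "\<dots> = \<kappa> *s (A (w d) + e d *s C (w d))"
    by (simp add: \<kappa> A.scale C.scale scale_right_distrib mult.commute)
  also have "\<dots> = (m * (\<kappa> * \<kappa>)) *s w d"
    unfolding up by (simp add: \<kappa> m_def mult_ac)
  finally have "m = m * (\<kappa> * \<kappa>)"
    using w_nz[of d] by simp
  then have "\<kappa> * \<kappa> = 1"
    using \<open>m \<noteq> 0\<close> by simp
  moreover have "\<kappa> \<noteq> - 1"
  proof
    assume "\<kappa> = - 1"
    \<comment> \<open>Alternating signs restore the boundary convention at the price of negating the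
      coefficients of \<open>A\<close>. The sum of the \<open>x i\<close> is then an
      \<open>A\<close>-eigenvector for \<open>- AB_eigval d 0\<close>, which does not occur among
      the eigenvalues on \<open>v\<close>.\<close>
    define x where "x i = (- 1) ^ i *s w i" for i
    have x_last: "x (Suc d) = x d"
      by (simp add: x_def \<kappa> \<open>\<kappa> = - 1\<close>)
    define \<alpha> \<beta> :: "nat \<Rightarrow> 'k" where "\<alpha> i = - (h * (2 * of_nat d - of_nat i + 2))"
      and "\<beta> i = - (h * of_nat i)" for i
    have "A (x i) = \<alpha> i *s prev x i + \<beta> (Suc i) *s x (Suc i)" for i
      unfolding x_def A.scale Aw scale_right_distrib
      by (cases i) (simp_all add: \<alpha>_def \<beta>_def mult_ac add.commute)
    then have "A (\<Sum>i\<le>d. x i) = (\<Sum>i\<le>d. \<alpha> i *s prev x i + \<beta> (Suc i) *s x (Suc i))"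
      by (simp add: A.sum)
    also have "\<dots> = (\<Sum>i\<le>d. (\<alpha> (Suc i) + \<beta> i) *s x i)"
      by (subst sum_prev_Suc) (simp_all add: x_last \<alpha>_def \<beta>_def algebra_simps)
    also have "\<dots> = (\<Sum>i\<le>d. (- AB_eigval d 0) *s x i)"
      by (simp add: \<alpha>_def \<beta>_def AB_eigval_def h_def algebra_simps)
    finally have "A (\<Sum>i\<le>d. x i) = (- AB_eigval d 0) *s (\<Sum>i\<le>d. x i)"
      by (simp add: scale_sum_right)
    moreover have "(\<Sum>i\<le>d. x i) \<noteq> 0"
      using indexed_basis_coeffs_zero[OF \<open>indexed_basis scale d w\<close>, of "\<lambda>i. (- 1) ^ i" 0]
      by (auto simp: x_def)
    ultimately obtain i where "i \<le> d" "- AB_eigval d 0 = (AB_eigval d i :: 'k)"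
      using eigenbasis_eigenvalue[OF AB_sequence_eigenbasis[OF tr v]] by metis
    then show False
      using AB_eigval_uminus_ne[of i d] by metis
  qed
  ultimately have "w (Suc d) = w d"
    using \<kappa> by (simp add: square_eq_1_iff)
  then have "AB_sequence scale d B A C w"
    using \<open>indexed_basis scale d w\<close> Aw Bw Cw unfolding AB_sequence_def \<theta>_def h_def by blast
  then show ?thesis
    by blast
qed

text \<open>The corner entry at \<open>(d, d)\<close> is the coefficient of
  \<open>u (Suc d)\<close>, folded back by \<open>u (Suc d) = u d\<close>.\<close>

lemma tridiagonal_column_sum:
  assumes "j \<le> d" and "u (Suc d) = u d"
  shows "(\<Sum>i\<le>d. (if j = i + 1 then p else if i = j + 1 then r else if i = d \<and> j = d then r else 0) *s u i) =
    p *s prev u j + r *s u (Suc j)"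
proof -
  have "(\<Sum>i\<le>d. (if j = i + 1 then p else if i = j + 1 then r else if i = d \<and> j = d then r else 0) *s u i) =
    (\<Sum>i\<le>d. (if j = i + 1 then p *s u i else 0) + ((if i = Suc j then r *s u (Suc j) else 0) +
       (if i = d then if j = d then r *s u d else 0 else 0)))"
    by (rule sum.cong) auto
  also have "\<dots> = (\<Sum>i\<le>d. if j = i + 1 then p *s u i else 0) + r *s u (Suc j)"
    using assms by (simp add: sum.distrib)
  also have "(\<Sum>i\<le>d. if j = i + 1 then p *s u i else 0) = p *s prev u j"
    using assms by (cases j) auto
  finally show ?thesis .
qed

end

section \<open>Scalars, relations and signs in the algebra\<close>

lemma free_const_central: "free_const r * p = p * (free_const r :: gword \<Rightarrow>\<^sub>0 'k::field)"
proof (induction p rule: Poly_Mapping.update_induct)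
  case (update f w k)
  \<comment> \<open>The key \<open>w\<close> is new, so the update adds a monomial, and monomials
    commute with constants because the empty word is neutral.\<close>
  have "Poly_Mapping.update w k f = f + Poly_Mapping.single w k"
    using update.hyps by (intro poly_mapping_eqI)
      (auto simp: Poly_Mapping.update.rep_eq lookup_add lookup_single when_def in_keys_iff)
  then show ?case
    using update.IH by (simp add: algebra_simps free_const_def mult_single)
qed simp

text \<open>Supplies the linearity of \<open>act p\<close> in scalars: \<open>A_module\<close>
  postulates only additivity and the action of constants.\<close>

lemma alg_const_central: "alg_const r * p = p * alg_const r"
  by transfer (simp add: free_const_central rel_cong_def rel_ideal.zero)

lemma alg_gen_anticommutator:
  assumes "a \<noteq> b" and "c \<noteq> a" and "c \<noteq> b"
  shows "alg_gen a * alg_gen b + alg_gen b * alg_gen a = (alg_gen c + alg_gen c :: 'k::field spin_alg)"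
proof -
  have rel: "rel_cong p (r + r)" if "p - 2 * r \<in> relators" for p r :: "gword \<Rightarrow>\<^sub>0 'k"
    using rel_ideal.gen[OF that, of 1 1] by (simp add: rel_cong_def mult_2)
  have "alg_gen gx * alg_gen gy + alg_gen gy * alg_gen gx = (alg_gen gz + alg_gen gz :: 'k spin_alg)"
    "alg_gen gy * alg_gen gz + alg_gen gz * alg_gen gy = (alg_gen gx + alg_gen gx :: 'k spin_alg)"
    "alg_gen gz * alg_gen gx + alg_gen gx * alg_gen gz = (alg_gen gy + alg_gen gy :: 'k spin_alg)"
    by (transfer; rule rel; simp add: relators_def)+
  then show ?thesis
    using assms by (cases a; cases b; cases c) (simp_all add: add.commute)
qed

lemma hat_mult_self: "hat a n * hat a n = (1 :: 'k::field)"
  by (simp add: hat_def)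

lemma hat_nonzero: "hat a n \<noteq> (0 :: 'k::field)"
  by (simp add: hat_def)

text \<open>For \<open>None\<close> all three signs are \<open>1\<close>, otherwise exactly two are
  \<open>- 1\<close>; hence their product is always \<open>1\<close>.\<close>

lemma hat_mult_distinct:
  assumes "a \<noteq> b" and "c \<noteq> a" and "c \<noteq> b"
  shows "hat a n * hat b n = (hat c n :: 'k::field)"
proof (cases n)
  case (Some g)
  then show ?thesis
    using assms by (cases a; cases b; cases c; cases g) (simp_all add: hat_def)
qed (simp add: hat_def)

lemma eigval_eq: "eigval d n a i = hat a n * AB_eigval d i"
  by (simp add: eigval_def AB_eigval_def mult.assoc)

section \<open>Modules of type AB and the three matrices\<close>

theorem theorem7p4:
  fixes scale :: "'k::{alg_closed_field, field_char_0} \<Rightarrow> 'v::ab_group_add \<Rightarrow> 'v"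
    and act :: "'k spin_alg \<Rightarrow> 'v \<Rightarrow> 'v"
    and d :: nat and n :: "gen option" and a b c :: gen and vb :: 'v
  assumes "A_module scale act"
    and "finite_dim scale"
    and "irreducible_module scale act"
    and "type_AB d n scale act"
    and "a \<noteq> b" and "c \<noteq> a" and "c \<noteq> b"
    and "vb \<in> range (idem d n scale act b 0)" and "vb \<noteq> 0"
  shows "let u = (\<lambda>i. idem d n scale act a i vb) in
           indexed_basis scale d u \<and>
           represents scale d u (act (alg_gen a)) (mat_diag d n a) \<and>
           represents scale d u (act (alg_gen b)) (mat_tri d n b) \<and>
           represents scale d u (act (alg_gen c)) (mat_alt_tri d n c)"
proof -
  interpret A_module scale act by fact
  interpret vector_space_char_0 scale ..
  have act_scale: "act p (scale r x) = scale r (act p x)" for p r x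
    by (metis act_const act_mult alg_const_central)
  \<comment> \<open>The generators without their signs. By \<open>hat_mult_distinct\<close> they
    still satisfy the relations.\<close>
  define \<phi> where "\<phi> g x = scale (hat g n) (act (alg_gen g) x)" for g x
  have act_\<phi>: "act (alg_gen g) x = scale (hat g n) (\<phi> g x)" for g x
    by (simp add: \<phi>_def hat_mult_self)
  have linear_act: "Vector_Spaces.linear scale scale (act p)" for p
    by (simp add: Vector_Spaces.linear_iff vector_space_axioms act_add_right act_scale)
  have linear_\<phi>: "Vector_Spaces.linear scale scale (\<phi> g)" for g
    by (simp add: Vector_Spaces.linear_iff vector_space_axioms act_add_right act_scale \<phi>_def
        scale_right_distrib mult.commute)
  have \<phi>_rel: "\<phi> g (\<phi> h x) + \<phi> h (\<phi> g x) = \<phi> k x + \<phi> k x" if "g \<noteq> h" "k \<noteq> g" "k \<noteq> h" for g h k x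
  proof -
    have "\<phi> g (\<phi> h x) + \<phi> h (\<phi> g x) =
        scale (hat g n * hat h n) (act (alg_gen g * alg_gen h + alg_gen h * alg_gen g) x)"
      by (simp add: \<phi>_def act_scale act_mult act_add_left scale_right_distrib mult.commute)
    also have "\<dots> = \<phi> k x + \<phi> k x"
      unfolding alg_gen_anticommutator[OF that] hat_mult_distinct[OF that]
      by (simp add: \<phi>_def act_add_left scale_right_distrib)
    finally show ?thesis .
  qed
  have tr: "anticomm_triple scale (\<phi> g) (\<phi> h) (\<phi> k)" if "g \<noteq> h" "k \<noteq> g" "k \<noteq> h" for g h k
    using that linear_\<phi> \<phi>_rel unfolding anticomm_triple_def by metis
  define AB where "AB g h k \<longleftrightarrow> (\<exists>v. AB_sequence scale d (\<phi> g) (\<phi> h) (\<phi> k) v)" for g h k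
  have xyz: "AB gx gy gz"
  proof -
    obtain v where v: "AB_basis d n scale act v"
      using \<open>type_AB d n scale act\<close> by (auto simp: type_AB_def)
    \<comment> \<open>\<open>AB_basis\<close> handles the boundary through \<open>extend\<close>;
      clamping the index stores \<open>v d\<close> at position \<open>d + 1\<close>.\<close>
    define v' where "v' i = v (min i d)" for i
    have v': "v' i = v i" if "i \<le> d" for i
      using that by (simp add: v'_def)
    have "indexed_basis scale d v"
      using v unfolding AB_basis_def by blast
    then have "indexed_basis scale d v'"
      by (rule indexed_basis_rescale[of d v "\<lambda>_. 1"]) (simp_all add: v')
    moreover have "v' (Suc d) = v' d"
      by (simp add: v'_def)
    moreover have "\<phi> gx (v' i) = scale (AB_eigval d i) (v' i) \<and>
        \<phi> gy (v' i) = scale ((- 1) ^ d * (2 * of_nat d - of_nat i + 2)) (prev v' i) +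
          scale ((- 1) ^ d * (of_nat i + 1)) (v' (Suc i)) \<and>
        \<phi> gz (v' i) = scale (- ((- 1) ^ i * (2 * of_nat d - of_nat i + 2))) (prev v' i) +
          scale ((- 1) ^ i * (of_nat i + 1)) (v' (Suc i))" if "i \<le> d" for i
    proof -
      have act_v:
        "act (alg_gen gx) (v i) =
          scale (hat gx n * (- 1) ^ (d + i) * (2 * of_nat d - 2 * of_nat i + 1)) (v i)"
        "act (alg_gen gy) (v i) = scale (hat gy n * (- 1) ^ d)
          (scale (2 * of_nat d - of_nat i + 2) (extend d v (int i - 1)) +
           scale (of_nat i + 1) (extend d v (int i + 1)))"
        "act (alg_gen gz) (v i) = scale (hat gz n)
          (scale ((- 1) powi (int i - 1) * (2 * of_nat d - of_nat i + 2)) (extend d v (int i - 1)) +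
           scale ((- 1) ^ i * (of_nat i + 1)) (extend d v (int i + 1)))"
        using v that unfolding AB_basis_def by blast+
      have lower: "extend d v (int i - 1) = prev v' i"
        using that by (cases i) (auto simp: extend_def v')
      have upper: "extend d v (int i + 1) = v' (Suc i)"
        using that by (auto simp: extend_def v'_def nat_add_distrib min_def)
      \<comment> \<open>This includes \<open>i = 0\<close>, where the exponent is
        \<open>- 1\<close>.\<close>
      have sign: "(- 1) powi (int i - 1) = - ((- 1) ^ i :: 'k)"
        by (cases i) (auto simp: power_int_minus)
      have hat_cancel: "scale (hat g n) (scale (hat g n) y) = y" for g y
        by (simp add: hat_mult_self)
      show ?thesis
        unfolding \<phi>_def v'[OF that] act_v lower upper sign mult.assoc scale_scale[symmetric] hat_cancel
        by (simp add: AB_eigval_def scale_right_distrib)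
    qed
    ultimately have "AB_sequence scale d (\<phi> gx) (\<phi> gy) (\<phi> gz) v'"
      unfolding AB_sequence_def by blast
    then show ?thesis
      by (auto simp: AB_def)
  qed
  \<comment> \<open>The two adjacent transpositions reach all six orderings from \<open>gx\<close>,
    \<open>gy\<close>, \<open>gz\<close>.\<close>
  have swap12: "AB h g k" and swap23: "AB g k h" if "AB g h k" "g \<noteq> h" "k \<noteq> g" "k \<noteq> h" for g h k
    using that AB_sequence_swap12[OF tr] AB_sequence_swap23[OF tr] unfolding AB_def by blast+
  have yxz: "AB gy gx gz" and xzy: "AB gx gz gy"
    using swap12[OF xyz] swap23[OF xyz] by simp_all
  have yzx: "AB gy gz gx" and zxy: "AB gz gx gy"
    using swap23[OF yxz] swap12[OF xzy] by simp_all
  have zyx: "AB gz gy gx"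
    using swap12[OF yzx] by simp
  have AB: "AB g h k" if "g \<noteq> h" "k \<noteq> g" "k \<noteq> h" for g h k
    using that xyz yxz xzy yzx zxy zyx by (cases g; cases h; cases k) simp_all
  note abc = \<open>a \<noteq> b\<close> \<open>c \<noteq> a\<close> \<open>c \<noteq> b\<close>
  obtain v where v: "AB_sequence scale d (\<phi> a) (\<phi> b) (\<phi> c) v"
    using AB[OF abc] unfolding AB_def by blast
  \<comment> \<open>This second ordering serves to make the \<open>b\<close>-eigenspaces
    one-dimensional.\<close>
  obtain w where w: "AB_sequence scale d (\<phi> b) (\<phi> a) (\<phi> c) w"
    using AB[OF abc(1)[symmetric] abc(3,2)] unfolding AB_def by blast
  have tr_abc: "anticomm_triple scale (\<phi> a) (\<phi> b) (\<phi> c)"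
    using tr[OF abc] .
  then have tr_bac: "anticomm_triple scale (\<phi> b) (\<phi> a) (\<phi> c)"
    by (rule anticomm_triple_swap12)
  have eb: "eigenbasis scale (act (alg_gen g)) (eigval d n g) d x"
    if "eigenbasis scale (\<phi> g) (AB_eigval d) d x" for g x
    using that linear_act
    by (auto simp: eigenbasis_def act_\<phi> hat_nonzero eigval_eq inj_on_def)
  have eb_a: "eigenbasis scale (act (alg_gen a)) (eigval d n a) d v"
    using eb AB_sequence_eigenbasis[OF tr_abc v] by blast
  have eb_b: "eigenbasis scale (act (alg_gen b)) (eigval d n b) d w"
    using eb AB_sequence_eigenbasis[OF tr_bac w] by blast
  define s where "s = (\<Sum>i\<le>d. v i)"
  have "s \<noteq> 0"
    using v indexed_basis_sum_nonzero by (simp add: s_def AB_sequence_def)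
  have "s \<in> eigenspace scale (act (alg_gen b)) (eigval d n b 0)"
    using AB_sequence_sum(1)[OF v tr_abc] by (simp add: s_def eigenspace_def act_\<phi> eigval_eq)
  moreover have "vb \<in> eigenspace scale (act (alg_gen b)) (eigval d n b 0)"
    using \<open>vb \<in> range _\<close> prim_idem_eigenbasis(2)[OF eb_b, of 0] by (simp add: idem_def)
  ultimately obtain p r where pr: "s = scale p (w 0)" "vb = scale r (w 0)"
    unfolding eigenspace_eigenbasis[OF eb_b le0] by blast
  \<comment> \<open>\<open>p\<close> is nonzero because \<open>s\<close> is, and \<open>r\<close>
    because \<open>vb\<close> is.\<close>
  define k where "k = r / p"
  have k: "vb = scale k s" "k \<noteq> 0"
    using pr \<open>s \<noteq> 0\<close> \<open>vb \<noteq> 0\<close> by (auto simp: k_def)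
  define x where "x i = scale k (v i)" for i
  have x: "AB_sequence scale d (\<phi> a) (\<phi> b) (\<phi> c) x"
    unfolding x_def by (rule AB_sequence_scale[OF tr_abc v \<open>k \<noteq> 0\<close>])
  define u where "u i = idem d n scale act a i vb" for i
  \<comment> \<open>The idempotent for \<open>i\<close> picks the summand \<open>v i\<close> out of
    \<open>vb = scale k s\<close>.\<close>
  have u: "u i = x i" if "i \<le> d" for i
  proof -
    interpret E: Vector_Spaces.linear scale scale "prim_idem scale (act (alg_gen a)) (eigval d n a i)"
      by (rule prim_idem_eigenbasis(1)[OF eb_a that])
    have "u i = (\<Sum>j\<le>d. scale k (if j = i then v i else 0))"
      unfolding u_def idem_def k s_def E.scale E.sum scale_sum_right
      by (rule sum.cong) (simp_all add: prim_idem_eigenbasis(3)[OF eb_a that])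
    also have "\<dots> = (\<Sum>j\<le>d. if j = i then x i else 0)"
      by (rule sum.cong) (auto simp: x_def)
    also have "\<dots> = x i"
      using that by simp
    finally show ?thesis .
  qed
  have x_last: "x (Suc d) = x d"
    using x by (simp add: AB_sequence_def)
  have represents_u: "represents scale d u T M"
    if "\<And>j. j \<le> d \<Longrightarrow> T (x j) = (\<Sum>i\<le>d. scale (M i j) (x i))" for T M
    using that by (simp add: represents_def u)
  have \<phi>_x: "\<phi> a (x j) = scale (AB_eigval d j) (x j)"
    "\<phi> b (x j) = scale ((- 1) ^ d * (2 * of_nat d - of_nat j + 2)) (prev x j) +
      scale ((- 1) ^ d * (of_nat j + 1)) (x (Suc j))"
    "\<phi> c (x j) = scale (- ((- 1) ^ j * (2 * of_nat d - of_nat j + 2))) (prev x j) +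
      scale ((- 1) ^ j * (of_nat j + 1)) (x (Suc j))" if "j \<le> d" for j
    using x that unfolding AB_sequence_def by blast+
  have "indexed_basis scale d x"
    using x unfolding AB_sequence_def by blast
  then have "indexed_basis scale d u"
    by (rule indexed_basis_rescale[of d x "\<lambda>_. 1"]) (simp_all add: u)
  moreover have "represents scale d u (act (alg_gen a)) (mat_diag d n a)"
  proof (rule represents_u)
    fix j assume "j \<le> d"
    have "(\<Sum>i\<le>d. scale (mat_diag d n a i j) (x i)) = (\<Sum>i\<le>d. if i = j then scale (eigval d n a j) (x j) else 0)"
      by (rule sum.cong) (auto simp: mat_diag_def eigval_def)
    then show "act (alg_gen a) (x j) = (\<Sum>i\<le>d. scale (mat_diag d n a i j) (x i))"
      using \<open>j \<le> d\<close> by (simp add: act_\<phi> eigval_eq \<phi>_x)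
  qed
  moreover have "represents scale d u (act (alg_gen b)) (mat_tri d n b)"
  proof (rule represents_u)
    fix j assume j: "j \<le> d"
    define p r :: 'k where "p = (- 1) ^ d * (2 * of_nat d - of_nat j + 2)" and "r = (- 1) ^ d * (of_nat j + 1)"
    have "mat_tri d n b i j = hat b n *
        (if j = i + 1 then p else if i = j + 1 then r else if i = d \<and> j = d then r else 0)" for i
      by (auto simp: mat_tri_def p_def r_def mult.assoc)
    then have "(\<Sum>i\<le>d. scale (mat_tri d n b i j) (x i)) = scale (hat b n) (scale p (prev x j) + scale r (x (Suc j)))"
      by (simp only: tridiagonal_column_sum[where u = x, OF j x_last, symmetric] scale_sum_right scale_scale)
    then show "act (alg_gen b) (x j) = (\<Sum>i\<le>d. scale (mat_tri d n b i j) (x i))"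
      unfolding act_\<phi> \<phi>_x[OF j] p_def r_def by simp
  qed
  moreover have "represents scale d u (act (alg_gen c)) (mat_alt_tri d n c)"
  proof (rule represents_u)
    fix j assume j: "j \<le> d"
    \<comment> \<open>The exponent \<open>j - 1\<close> in \<open>mat_alt_tri\<close> is read only
      for \<open>j = i + 1\<close>, so it is never truncated and contributes the sign in
      \<open>p\<close>.\<close>
    define p r :: 'k where "p = - ((- 1) ^ j * (2 * of_nat d - of_nat j + 2))" and "r = (- 1) ^ j * (of_nat j + 1)"
    have "mat_alt_tri d n c i j = hat c n *
        (if j = i + 1 then p else if i = j + 1 then r else if i = d \<and> j = d then r else 0)" for i
      by (auto simp: mat_alt_tri_def p_def r_def)
    then have "(\<Sum>i\<le>d. scale (mat_alt_tri d n c i j) (x i)) = scale (hat c n) (scale p (prev x j) + scale r (x (Suc j)))"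
      by (simp only: tridiagonal_column_sum[where u = x, OF j x_last, symmetric] scale_sum_right scale_scale)
    then show "act (alg_gen c) (x j) = (\<Sum>i\<le>d. scale (mat_alt_tri d n c i j) (x i))"
      unfolding act_\<phi> \<phi>_x[OF j] p_def r_def by simp
  qed
  ultimately show ?thesis
    unfolding Let_def u_def by blast
qed

end
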